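(* Let $S:=\mathbb{K}e+\mathbb{K}v$ be the two-dimensional associative algebra with basis $\{e,v\}$ determined by $e^2=e$, $ev=0$, $ve=v$ and $v^2=0$. Then the Lie algebra $(S[t],\langle-,-\rangle)$ does not satisfy the standard identity $\mathrm{St}_5$.
   Context: $\mathbb{K}$ is a field of characteristic zero. $S[t]$ is the algebra of polynomials in the (central) indeterminate $t$ with coefficients in $S$, $a'=\frac{d}{dt}a$, and $\langle a,b\rangle:=b'a-a'b$, which is a Lie bracket on $S[t]$ because $S[S,S]=0$. For a Lie algebra with bracket $[-,-]$, $$\mathrm{St}_{n+1}(x_1,\dots,x_n,z):=\sum_{\sigma}(-1)^{\sigma}[x_{\sigma(1)},[x_{\sigma(2)},[\cdots,[x_{\sigma(n)},z]\cdots]]],$$ where $\sigma$ runs over the symmetric group of degree $n$ and $(-1)^\sigma$ is the sign of $\sigma$. The Lie algebra satisfies $\mathrm{St}_{n+1}$ if this expression vanishes for all $x_1,\dots,x_n,z$ in it. *)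

theory Defs
  imports "HOL-Computational_Algebra.Polynomial" "HOL-Combinatorics.Permutations"
begin

section \<open>Lie algebras and standard identities\<close>

locale lie_algebra = vector_space scale
  for scale :: "'k::field \<Rightarrow> 'l::ab_group_add \<Rightarrow> 'l" +
  fixes bracket :: "'l \<Rightarrow> 'l \<Rightarrow> 'l"
  assumes add_left: "bracket (x + y) z = bracket x z + bracket y z"
    and add_right: "bracket z (x + y) = bracket z x + bracket z y"
    and scale_left: "bracket (scale c x) y = scale c (bracket x y)"
    and scale_right: "bracket x (scale c y) = scale c (bracket x y)"
    and alternating: "bracket x x = 0"
    and jacobi: "bracket x (bracket y z) + bracket y (bracket z x) + bracket z (bracket x y) = 0"

text \<open>
  The index counts all variables: for \<open>m = n + 1\<close> the alternating variables are
  \<open>x 1, \<dots>, x n\<close>, the permutations run over \<open>{1..n} = {1..<m}\<close>, and the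
  \<open>foldr\<close> is \<open>[x (\<sigma> 1), [x (\<sigma> 2), \<dots> [x (\<sigma> n), z] \<dots>]]\<close>.
  Only the values of \<open>x\<close> on \<open>{1..<m}\<close> matter.
\<close>

definition St :: "nat \<Rightarrow> ('l::ab_group_add \<Rightarrow> 'l \<Rightarrow> 'l) \<Rightarrow> (nat \<Rightarrow> 'l) \<Rightarrow> 'l \<Rightarrow> 'l" where
  "St m bracket x z =
     (\<Sum>\<sigma> | \<sigma> permutes {1..<m}.
        let w = foldr (\<lambda>i. bracket (x (\<sigma> i))) [1..<m] z
        in if evenperm \<sigma> then w else - w)"

definition satisfies_St :: "nat \<Rightarrow> ('l::ab_group_add \<Rightarrow> 'l \<Rightarrow> 'l) \<Rightarrow> bool" where
  "satisfies_St m bracket \<longleftrightarrow> (\<forall>x z. St m bracket x z = 0)"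


section \<open>The algebra S\<close>

text \<open>\<open>Comb a b\<close> stands for \<open>a e + b v\<close>.\<close>

datatype 'k S_alg = Comb (e_coord: 'k) (v_coord: 'k)

text \<open>
  By the multiplication table, \<open>(a e + b v) (c e + d v) = a c e + b c v\<close>.
  The class \<open>ring\<close> is that of associative rings, not necessarily commutative or unital.
\<close>

instantiation S_alg :: (field) ring
begin

definition "0 = Comb 0 0"
definition "x + y = Comb (e_coord x + e_coord y) (v_coord x + v_coord y)"
definition "x - y = Comb (e_coord x - e_coord y) (v_coord x - v_coord y)"
definition "- x = Comb (- e_coord x) (- v_coord x)"
definition "x * y = Comb (e_coord x * e_coord y) (v_coord x * e_coord y)"

instance
  by standard
    (auto simp: zero_S_alg_def plus_S_alg_def minus_S_alg_def uminus_S_alg_def times_S_alg_def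
      algebra_simps)

end

definition S_e :: "'k::field S_alg" where "S_e = Comb 1 0"

definition S_v :: "'k::field S_alg" where "S_v = Comb 0 1"

definition S_scale :: "'k::field \<Rightarrow> 'k S_alg \<Rightarrow> 'k S_alg" where
  "S_scale c x = Comb (c * e_coord x) (c * v_coord x)"

lemmas S_defs = zero_S_alg_def plus_S_alg_def minus_S_alg_def uminus_S_alg_def times_S_alg_def
  S_e_def S_v_def S_scale_def

lemma S_mult_table:
  "S_e * S_e = S_e" "S_e * S_v = 0" "S_v * S_e = S_v" "S_v * S_v = 0"
  by (simp_all add: S_defs)

interpretation S: vector_space S_scale
  by standard (auto simp: S_defs algebra_simps)

lemma S_scale_mult:
  "S_scale c x * y = S_scale c (x * y)" "x * S_scale c y = S_scale c (x * y)"
  by (simp_all add: S_defs)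

lemma S_basis:
  "S_e \<noteq> S_v" "S.independent {S_e, S_v}" "S.span {S_e, S_v} = UNIV"
proof -
  show ne: "S_e \<noteq> S_v" by (simp add: S_defs)
  have "x \<in> S.span {S_e, S_v}" for x
  proof -
    have "x = S_scale (e_coord x) S_e + S_scale (v_coord x) S_v"
      by (cases x) (simp add: S_defs)
    then show ?thesis
      by (metis S.span_add S.span_base S.span_scale insertI1 insertI2)
  qed
  then show "S.span {S_e, S_v} = UNIV" by blast
  show "S.independent {S_e, S_v}"
    using ne by (auto simp: S.independent_insert S.span_singleton S_defs)
qed


section \<open>Polynomials over S\<close>

text \<open>
  The library's multiplication and derivative on \<^typ>\<open>'a poly\<close> need commutative unital
  coefficients, so those of \<open>S[t]\<close> are given here, with \<open>t\<close> central:
  \<open>(a t\<^sup>i) (b t\<^sup>j) = a b t\<^sup>i\<^sup>+\<^sup>j\<close>.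
\<close>

definition poly_prod :: "'a::ring poly \<Rightarrow> 'a poly \<Rightarrow> 'a poly" where
  "poly_prod p q = (\<Sum>i\<le>degree p. \<Sum>j\<le>degree q. monom (coeff p i * coeff q j) (i + j))"

definition poly_scale :: "'k::field \<Rightarrow> 'k S_alg poly \<Rightarrow> 'k S_alg poly" where
  "poly_scale c = map_poly (S_scale c)"

definition poly_deriv :: "'k::field S_alg poly \<Rightarrow> 'k S_alg poly" where
  "poly_deriv p = (\<Sum>i\<le>degree p. monom (S_scale (of_nat i) (coeff p i)) (i - 1))"

definition S_bracket :: "'k::field S_alg poly \<Rightarrow> 'k S_alg poly \<Rightarrow> 'k S_alg poly" where
  "S_bracket a b = poly_prod (poly_deriv b) a - poly_prod (poly_deriv a) b"

lemma coeff_poly_prod: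
  "coeff (poly_prod p q) n = (\<Sum>i\<le>n. coeff p i * coeff q (n - i))"
proof -
  have inner: "(\<Sum>j\<le>degree q. if i + j = n then coeff p i * coeff q j else 0) =
      (if i \<le> n then coeff p i * coeff q (n - i) else 0)" for i
  proof (cases "i \<le> n")
    case True
    then have "(\<Sum>j\<le>degree q. if i + j = n then coeff p i * coeff q j else 0) =
        (\<Sum>j\<le>degree q. if j = n - i then coeff p i * coeff q j else 0)"
      by (intro sum.cong) auto
    with True show ?thesis by (auto simp: sum.delta coeff_eq_0)
  qed (auto intro: sum.neutral)
  have "coeff (poly_prod p q) n =
      (\<Sum>i\<le>degree p. if i \<le> n then coeff p i * coeff q (n - i) else 0)"
    by (simp add: poly_prod_def coeff_sum inner)
  also have "\<dots> = (\<Sum>i\<le>n. coeff p i * coeff q (n - i))"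
    by (rule sum.mono_neutral_cong) (auto simp: coeff_eq_0)
  finally show ?thesis .
qed

lemma coeff_poly_scale: "coeff (poly_scale c p) n = S_scale c (coeff p n)"
  by (simp add: poly_scale_def coeff_map_poly)

lemma coeff_poly_deriv:
  "coeff (poly_deriv p) n = S_scale (of_nat (Suc n)) (coeff p (Suc n))"
proof -
  have "coeff (poly_deriv p) n =
      (\<Sum>i\<le>degree p. if i = Suc n then S_scale (of_nat i) (coeff p i) else 0)"
    unfolding poly_deriv_def coeff_sum coeff_monom
  proof (intro sum.cong refl)
    fix i
    show "(if i - 1 = n then S_scale (of_nat i) (coeff p i) else 0) =
        (if i = Suc n then S_scale (of_nat i) (coeff p i) else 0)"
      by (cases i) simp_all
  qed
  also have "\<dots> = S_scale (of_nat (Suc n)) (coeff p (Suc n))"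
    by (auto simp: sum.delta coeff_eq_0 simp del: of_nat_Suc)
  finally show ?thesis .
qed

definition e_part :: "'k::field S_alg poly \<Rightarrow> 'k poly" where "e_part = map_poly e_coord"

definition v_part :: "'k::field S_alg poly \<Rightarrow> 'k poly" where "v_part = map_poly v_coord"

lemma coeff_parts:
  "coeff (e_part p) n = e_coord (coeff p n)" "coeff (v_part p) n = v_coord (coeff p n)"
  by (simp_all add: e_part_def v_part_def coeff_map_poly zero_S_alg_def)

lemma S_poly_eq_iff: "p = q \<longleftrightarrow> e_part p = e_part q \<and> v_part p = v_part q"
  by (auto simp: poly_eq_iff coeff_parts S_alg.expand)

lemma coord_sum:
  "e_coord (sum f A) = (\<Sum>i\<in>A. e_coord (f i))" "v_coord (sum f A) = (\<Sum>i\<in>A. v_coord (f i))"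
  by (induction A rule: infinite_finite_induct) (simp_all add: S_defs)

lemma parts_simps:
  "e_part 0 = 0" "v_part 0 = 0"
  "e_part (p + q) = e_part p + e_part q" "v_part (p + q) = v_part p + v_part q"
  "e_part (p - q) = e_part p - e_part q" "v_part (p - q) = v_part p - v_part q"
  "e_part (poly_scale c p) = smult c (e_part p)" "v_part (poly_scale c p) = smult c (v_part p)"
  "e_part (poly_prod p q) = e_part p * e_part q" "v_part (poly_prod p q) = v_part p * e_part q"
  "e_part (poly_deriv p) = pderiv (e_part p)" "v_part (poly_deriv p) = pderiv (v_part p)"
  by (simp_all add: poly_eq_iff coeff_parts coeff_poly_prod coeff_poly_scale coeff_poly_deriv
      coeff_pderiv coeff_mult coord_sum S_defs del: of_nat_Suc)

lemma S_lie_algebra: "lie_algebra poly_scale S_bracket"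
  by standard
    (simp_all add: S_bracket_def S_poly_eq_iff parts_simps pderiv_add pderiv_diff pderiv_mult
      pderiv_smult smult_add_left smult_add_right smult_diff_right algebra_simps)

end

theory Submission
  imports Defs
begin

text \<open>
  Write an element of \<open>S[t]\<close> as \<open>f e + g v\<close> with polynomials \<open>f\<close> and \<open>g\<close>. The bracket is then
  \<open>\<langle>f e + g v, h e + k v\<rangle> = (f h' - f' h) e + (f k' - g' h) v\<close>. On the \<open>e\<close>-components it is the
  Lie algebra of vector fields \<open>f d/dt\<close> on the line. On the \<open>v\<close>-components, \<open>f e\<close> acts on \<open>k v\<close>
  by the derivation \<open>f d/dt\<close>, so the span of the \<open>g v\<close> is an abelian ideal.

  The expression \<open>St\<^sub>5\<close> therefore becomes linear in \<open>g\<close> as soon as one of the alternating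
  variables is \<open>g v\<close> and all other variables are multiples of \<open>e\<close>. It distributes four
  derivatives, alternates in the three remaining polynomials \<open>f\<^sub>1, f\<^sub>2, f\<^sub>3\<close>, and \<open>g\<close> occurs in it
  only differentiated. An alternating expression in three polynomials needs at least
  \<open>0 + 1 + 2\<close> derivatives, which leaves exactly one for \<open>g\<close> and none for \<open>z = h e\<close>, so that
  \<open>St\<^sub>5\<close> is a constant multiple of \<open>g' h W(f\<^sub>1, f\<^sub>2, f\<^sub>3) v\<close>, where \<open>W\<close> is the Wronskian. The simplest
  arguments with a nonzero Wronskian are \<open>1, t, t\<^sup>2\<close>; with \<open>g = t\<close> and \<open>h = 1\<close> the result is the
  constant \<open>-4 v\<close>, which is not zero in characteristic zero. The choice \<open>h = 1\<close> makes all but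
  four of the 24 summands vanish.
\<close>

lemma monom_Comb_zero: "monom (Comb 0 0 :: 'k::field S_alg) n = 0"
  by (metis monom_eq_0 zero_S_alg_def)

lemma poly_prod_0: "poly_prod 0 p = 0" "poly_prod p 0 = 0"
  by (simp_all add: poly_prod_def)

lemma S_bracket_0: "S_bracket 0 p = 0" "S_bracket p 0 = 0"
  by (simp_all add: S_bracket_def poly_deriv_def poly_prod_0)

lemma poly_deriv_monom: "poly_deriv (monom a i) = monom (S_scale (of_nat i) a) (i - 1)"
  by (cases i) (auto simp: poly_eq_iff coeff_poly_deriv S_defs simp del: of_nat_Suc)

lemma poly_prod_monom: "poly_prod (monom a i) (monom b j) = monom (a * b) (i + j)"
proof (rule poly_eqI)
  fix n
  have "coeff (poly_prod (monom a i) (monom b j)) n =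
      (\<Sum>k\<le>n. if k = i then a * coeff (monom b j) (n - i) else 0)"
    unfolding coeff_poly_prod by (intro sum.cong) auto
  also have "\<dots> = coeff (monom (a * b) (i + j)) n"
    by (auto simp: sum.delta)
  finally show "coeff (poly_prod (monom a i) (monom b j)) n = coeff (monom (a * b) (i + j)) n" .
qed

text \<open>
  Monomials are closed under the bracket, so that iterated brackets of monomials can be
  evaluated by rewriting. The truncated exponent is harmless: for \<open>i + j = 0\<close> the coefficient
  vanishes.
\<close>

lemma S_bracket_monom:
  "S_bracket (monom a i) (monom b j) =
     monom (S_scale (of_nat j) (b * a) - S_scale (of_nat i) (a * b)) (i + j - 1)"
  by (cases i; cases j)
    (simp_all add: S_bracket_def poly_deriv_monom poly_prod_monom S_scale_mult diff_monom
      poly_prod_0 minus_monom add.commute del: of_nat_Suc)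

text \<open>
  The 24 permutations are listed as products of transpositions, by which sign and values are
  computed together.
\<close>

lemma St_5_S_bracket_value:
  fixes x :: "nat \<Rightarrow> 'k::field_char_0 S_alg poly"
  assumes "x 1 = monom S_e 0" "x 2 = monom S_e 1" "x 3 = monom S_e 2" "x 4 = monom S_v 1"
  shows "St 5 S_bracket x (monom S_e 0) = monom (S_scale (- 4) S_v) 0"
proof -
  have indices: "{1..<5} = insert 1 (insert 2 (insert 3 {4::nat}))" "[1..<5] = [1, 2, 3, 4]"
    by (auto simp: upt_rec)
  show ?thesis
    unfolding St_def indices
    by (simp add: sum_over_permutations_insert permutes_sing evenperm_comp evenperm_swap
        permutation_compose permutation_swap_id transpose_def assms S_bracket_monom S_bracket_0
        S_defs monom_Comb_zero add_monom minus_monom Let_def del: One_nat_def)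
qed

theorem proposition6p2:
  shows "\<not> satisfies_St 5 (S_bracket :: 'k::field_char_0 S_alg poly \<Rightarrow> 'k S_alg poly \<Rightarrow> 'k S_alg poly)"
proof
  assume identity:
    "satisfies_St 5 (S_bracket :: 'k S_alg poly \<Rightarrow> 'k S_alg poly \<Rightarrow> 'k S_alg poly)"
  define x :: "nat \<Rightarrow> 'k S_alg poly"
    where "x i = (if i = 4 then monom S_v 1 else monom S_e (i - 1))" for i
  have "monom (S_scale (- 4) S_v) 0 = St 5 S_bracket x (monom S_e 0)"
    by (rule St_5_S_bracket_value [symmetric]) (simp_all add: x_def)
  also have "\<dots> = 0"
    using identity by (simp add: satisfies_St_def)
  finally show False
    by (simp add: S_defs)
qed

end
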